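(* Let $B\ge 2$. The smallest Gaussian $B$-happy number of height $0$ is $1$, the smallest of height $1$ is $-1$, and the smallest Gaussian $B$-happy numbers of height $2$ are $i$ and $-i$.
   Context: Fix an integer $B\ge 2$. Every nonzero Gaussian integer $a+bi$ is written uniquely as $a+bi=\sum_{j=0}^n (a_j+b_ji)B^j$ with $a_j,b_j\in\mathbb{Z}$, $a_n,b_n$ not both $0$, and for each $j$: $|a_j|\le B-1$, $|b_j|\le B-1$, $\operatorname{sgn}(a)a_j\ge 0$, $\operatorname{sgn}(b)b_j\ge 0$. The Gaussian $B$-happy function $S_B:\mathbb{Z}[i]\to\mathbb{Z}[i]$ is defined by $S_B(0)=0$ and $S_B(a+bi)=\sum_{j=0}^n (a_j+b_ji)^2$. A Gaussian integer $z$ is Gaussian $B$-happy if $S_B^k(z)=1$ for some $k\ge1$. The height of a Gaussian $B$-happy number $z$ is the least $k\in\mathbb{Z}_{\ge0}$ with $S_B^k(z)=1$ ($S_B^0$ is the identity). "Smallest" means of minimal complex absolute value; the smallest numbers of a given height are all Gaussian $B$-happy numbers of that height attaining the minimal absolute value among such numbers. *)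

theory Defs
  imports Complex_Main
begin

definition gaussian_ints :: "complex set" where
  "gaussian_ints = {z. Re z \<in> \<int> \<and> Im z \<in> \<int>}"

definition gaussian_expansion ::
    "int \<Rightarrow> complex \<Rightarrow> nat \<Rightarrow> (nat \<Rightarrow> int) \<Rightarrow> (nat \<Rightarrow> int) \<Rightarrow> bool" where
  "gaussian_expansion B z n a b \<longleftrightarrow>
     z = (\<Sum>j\<le>n. (of_int (a j) + of_int (b j) * \<i>) * of_int B ^ j) \<and>
     (a n \<noteq> 0 \<or> b n \<noteq> 0) \<and>
     (\<forall>j\<le>n. \<bar>a j\<bar> \<le> B - 1 \<and> \<bar>b j\<bar> \<le> B - 1 \<and>
            sgn (Re z) * of_int (a j) \<ge> 0 \<and> sgn (Im z) * of_int (b j) \<ge> 0)"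

text \<open>The description below is meaningful only for Gaussian integers and \<open>B \<ge> 2\<close>;
  see \<open>gaussian_expansion_exists\<close> and \<open>gaussian_happy_fun_eq\<close>.\<close>

definition gaussian_happy_fun :: "int \<Rightarrow> complex \<Rightarrow> complex" where
  "gaussian_happy_fun B z =
     (if z = 0 then 0
      else THE s. \<exists>n a b. gaussian_expansion B z n a b \<and>
                          s = (\<Sum>j\<le>n. (of_int (a j) + of_int (b j) * \<i>)\<^sup>2))"

definition gaussian_happy :: "int \<Rightarrow> complex \<Rightarrow> bool" where
  "gaussian_happy B z \<longleftrightarrow>
     z \<in> gaussian_ints \<and> (\<exists>k\<ge>1. (gaussian_happy_fun B ^^ k) z = 1)"

definition happy_height :: "int \<Rightarrow> complex \<Rightarrow> nat" where
  "happy_height B z = (LEAST k. (gaussian_happy_fun B ^^ k) z = 1)"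

definition smallest_happy_of_height :: "int \<Rightarrow> nat \<Rightarrow> complex set" where
  "smallest_happy_of_height B k =
     {z. is_arg_min cmod (\<lambda>w. gaussian_happy B w \<and> happy_height B w = k) z}"

lemma digits_zero:
  fixes e :: "nat \<Rightarrow> int"
  assumes "B \<ge> 2" "\<And>j. \<bar>e j\<bar> \<le> B - 1" "(\<Sum>j<n. e j * B ^ j) = 0" "j < n"
  shows "e j = 0"
  using assms(2-)
proof (induction n arbitrary: e j)
  case (Suc n)
  have split: "(\<Sum>j<Suc n. e j * B ^ j) = e 0 + B * (\<Sum>j<n. e (Suc j) * B ^ j)"
    unfolding sum.lessThan_Suc_shift by (simp add: sum_distrib_left mult_ac)
  then have "B dvd e 0"
    using Suc.prems(2) by (metis dvd_add_left_iff dvd_triv_left dvd_0_right)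
  then have e0: "e 0 = 0"
    using Suc.prems(1)[of 0] assms(1) dvd_imp_le_int[of "e 0" B] by fastforce
  then have "(\<Sum>j<n. e (Suc j) * B ^ j) = 0"
    using split Suc.prems(2) assms(1) by simp
  then have "e (Suc i) = 0" if "i < n" for i
    using Suc.IH[of "\<lambda>j. e (Suc j)"] Suc.prems(1) that by blast
  then show ?case
    using e0 Suc.prems(3) by (cases j) blast+
qed simp

lemma digits_unique:
  fixes a c :: "nat \<Rightarrow> int" and x :: int
  assumes B: "B \<ge> 2"
    and "\<And>j. \<bar>a j\<bar> \<le> B - 1" "\<And>j. \<bar>c j\<bar> \<le> B - 1"
    and "\<And>j. sgn x * a j \<ge> 0" "\<And>j. sgn x * c j \<ge> 0"
    and "(\<Sum>j<n. a j * B ^ j) = x" "(\<Sum>j<n. c j * B ^ j) = x"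
    and "j < n"
  shows "a j = c j"
proof (cases "x = 0")
  case True
  then show ?thesis using digits_zero[OF B, of a n j] digits_zero[OF B, of c n j] assms by simp
next
  case False
  have "\<bar>a j - c j\<bar> \<le> B - 1" for j
    using assms(2)[of j] assms(3)[of j] assms(4)[of j] assms(5)[of j] False
    by (cases "x > 0") auto
  moreover have "(\<Sum>j<n. (a j - c j) * B ^ j) = 0"
    using assms(6,7) by (simp add: left_diff_distrib sum_subtractf)
  ultimately show ?thesis
    using digits_zero[OF B, of "\<lambda>j. a j - c j" n j] assms(8) by simp
qed

lemma gaussian_expansion_iff:
  "gaussian_expansion B (Complex (of_int x) (of_int y)) n a b \<longleftrightarrow>
     x = (\<Sum>j\<le>n. a j * B ^ j) \<and> y = (\<Sum>j\<le>n. b j * B ^ j) \<and>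
     (a n \<noteq> 0 \<or> b n \<noteq> 0) \<and>
     (\<forall>j\<le>n. \<bar>a j\<bar> \<le> B - 1 \<and> \<bar>b j\<bar> \<le> B - 1 \<and> sgn x * a j \<ge> 0 \<and> sgn y * b j \<ge> 0)"
proof -
  have summand: "(of_int u + of_int v * \<i>) * of_int B ^ j =
      Complex (of_int (u * B ^ j)) (of_int (v * B ^ j))" for u v j
    by (simp add: complex_eq_iff flip: of_int_power of_int_mult)
  have "(\<Sum>j\<le>n. (of_int (a j) + of_int (b j) * \<i>) * of_int B ^ j) =
      Complex (of_int (\<Sum>j\<le>n. a j * B ^ j)) (of_int (\<Sum>j\<le>n. b j * B ^ j))"
    unfolding summand by (simp add: complex_eq_iff)
  moreover have "sgn (of_int u :: real) * of_int v \<ge> 0 \<longleftrightarrow> sgn u * v \<ge> 0" for u v :: int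
    by (simp add: sgn_if)
  ultimately show ?thesis
    unfolding gaussian_expansion_def by (simp only: complex.sel complex.inject of_int_eq_iff conj_assoc)
qed

lemma gaussian_intsE:
  assumes "z \<in> gaussian_ints"
  obtains x y where "z = Complex (of_int x) (of_int y)"
proof -
  obtain x y where "Re z = of_int x" "Im z = of_int y"
    using assms by (auto simp: gaussian_ints_def elim!: Ints_cases)
  then show thesis by (intro that[of x y]) (simp add: complex_eq_iff)
qed

lemma gaussian_expansion_unique:
  assumes B: "B \<ge> 2" and z: "z \<in> gaussian_ints"
    and "gaussian_expansion B z n a b" "gaussian_expansion B z m c d"
  shows "n = m" "\<forall>j\<le>n. a j = c j \<and> b j = d j"
proof -
  obtain x y where xy: "z = Complex (of_int x) (of_int y)"
    using z by (rule gaussian_intsE)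
  define N where "N = Suc (max n m)"
  define pad where "pad k f j = (if j \<le> k then f j else 0)" for k and f :: "nat \<Rightarrow> int" and j :: nat
  have pad: "(\<Sum>j<N. pad k f j * B ^ j) = (\<Sum>j\<le>k. f j * B ^ j)" if "k < N" for k f
    using that by (intro sum.mono_neutral_cong_right) (auto simp: pad_def)
  have ex: "gaussian_expansion B (Complex (of_int x) (of_int y)) n a b"
      "gaussian_expansion B (Complex (of_int x) (of_int y)) m c d"
    using assms(3,4) xy by auto
  note ex = ex[unfolded gaussian_expansion_iff]
  have lt: "n < N" "m < N" by (auto simp: N_def)
  have 1: "pad n a j = pad m c j" if "j < N" for j
  proof (rule digits_unique[OF B, where x = x and n = N])
    show "(\<Sum>j<N. pad n a j * B ^ j) = x" "(\<Sum>j<N. pad m c j * B ^ j) = x"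
      unfolding pad[OF lt(1)] pad[OF lt(2)] using ex by simp_all
    show "\<bar>pad n a j\<bar> \<le> B - 1" "sgn x * pad n a j \<ge> 0" for j
      using ex(1) B unfolding pad_def by (cases "j \<le> n"; simp)+
    show "\<bar>pad m c j\<bar> \<le> B - 1" "sgn x * pad m c j \<ge> 0" for j
      using ex(2) B unfolding pad_def by (cases "j \<le> m"; simp)+
  qed (rule that)
  have 2: "pad n b j = pad m d j" if "j < N" for j
  proof (rule digits_unique[OF B, where x = y and n = N])
    show "(\<Sum>j<N. pad n b j * B ^ j) = y" "(\<Sum>j<N. pad m d j * B ^ j) = y"
      unfolding pad[OF lt(1)] pad[OF lt(2)] using ex by simp_all
    show "\<bar>pad n b j\<bar> \<le> B - 1" "sgn y * pad n b j \<ge> 0" for j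
      using ex(1) B unfolding pad_def by (cases "j \<le> n"; simp)+
    show "\<bar>pad m d j\<bar> \<le> B - 1" "sgn y * pad m d j \<ge> 0" for j
      using ex(2) B unfolding pad_def by (cases "j \<le> m"; simp)+
  qed (rule that)
  show nm: "n = m"
  proof (rule antisym)
    have "a n \<noteq> 0 \<or> b n \<noteq> 0" using ex(1) by blast
    then show "n \<le> m" using 1[OF lt(1)] 2[OF lt(1)] unfolding pad_def by presburger
    have "c m \<noteq> 0 \<or> d m \<noteq> 0" using ex(2) by blast
    then show "m \<le> n" using 1[OF lt(2)] 2[OF lt(2)] unfolding pad_def by presburger
  qed
  show "\<forall>j\<le>n. a j = c j \<and> b j = d j"
  proof (intro allI impI)
    fix j assume j: "j \<le> n"
    then have "j < N" using lt by simp
    from 1[OF this] 2[OF this] show "a j = c j \<and> b j = d j"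
      using j nm by (simp add: pad_def)
  qed
qed

lemma gaussian_happy_fun_eq:
  assumes "B \<ge> 2" "z \<in> gaussian_ints" "z \<noteq> 0" "gaussian_expansion B z n a b"
  shows "gaussian_happy_fun B z = (\<Sum>j\<le>n. (of_int (a j) + of_int (b j) * \<i>)\<^sup>2)"
proof -
  have "(\<Sum>j\<le>m. (of_int (c j) + of_int (d j) * \<i>)\<^sup>2) =
      (\<Sum>j\<le>n. (of_int (a j) + of_int (b j) * \<i>)\<^sup>2)"
    if "gaussian_expansion B z m c d" for m c d
    using gaussian_expansion_unique[OF assms(1,2) that assms(4)] by (intro sum.cong) simp_all
  then have "(THE s. \<exists>n a b. gaussian_expansion B z n a b \<and>
      s = (\<Sum>j\<le>n. (of_int (a j) + of_int (b j) * \<i>)\<^sup>2)) =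
      (\<Sum>j\<le>n. (of_int (a j) + of_int (b j) * \<i>)\<^sup>2)"
    using assms(4) by (intro the_equality) blast+
  then show ?thesis
    unfolding gaussian_happy_fun_def using assms(3) by simp
qed

lemma digits_exist:
  fixes x :: int
  assumes B: "B \<ge> 2" and "\<bar>x\<bar> < B ^ n"
  shows "\<exists>a. x = (\<Sum>j<n. a j * B ^ j) \<and> (\<forall>j. \<bar>a j\<bar> \<le> B - 1 \<and> sgn x * a j \<ge> 0)"
proof -
  define u where "u = (\<lambda>j. \<bar>x\<bar> div B ^ j mod B)"
  have "(\<Sum>j<m. u j * B ^ j) = \<bar>x\<bar> mod B ^ m" for m
  proof (induction m)
    case (Suc m)
    then show ?case
      using B zmod_zmult2_eq[of B "\<bar>x\<bar>" "B ^ m"]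
      by (simp add: u_def power_Suc2 mult.commute del: power_Suc)
  qed simp
  then have "(\<Sum>j<n. u j * B ^ j) = \<bar>x\<bar>"
    using assms by simp
  then have "x = (\<Sum>j<n. (sgn x * u j) * B ^ j)"
    by (simp add: mult.assoc sgn_mult_abs flip: sum_distrib_left)
  moreover have u: "0 \<le> u j" "u j \<le> B - 1" for j
    using B pos_mod_bound[of B] by (auto simp: u_def)
  have "\<bar>sgn x * u j\<bar> \<le> B - 1 \<and> sgn x * (sgn x * u j) \<ge> 0" for j
    using u[of j] B by (auto simp: sgn_if)
  ultimately show ?thesis by (intro exI[of _ "\<lambda>j. sgn x * u j"]) blast
qed

lemma gaussian_expansion_exists:
  assumes B: "B \<ge> 2" and z: "z \<in> gaussian_ints" "z \<noteq> 0"
  shows "\<exists>n a b. gaussian_expansion B z n a b"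
proof -
  obtain x y where xy: "z = Complex (of_int x) (of_int y)"
    using z(1) by (rule gaussian_intsE)
  define N where "N = nat (\<bar>x\<bar> + \<bar>y\<bar>)"
  have "int N < 2 ^ N"
    by (rule of_nat_less_two_power)
  also have "(2::int) ^ N \<le> B ^ N"
    using B by (intro power_mono) auto
  finally have lt: "\<bar>x\<bar> < B ^ N" "\<bar>y\<bar> < B ^ N"
    by (auto simp: N_def)
  obtain a where a: "x = (\<Sum>j<N. a j * B ^ j)" "\<forall>j. \<bar>a j\<bar> \<le> B - 1 \<and> sgn x * a j \<ge> 0"
    using digits_exist[OF B lt(1)] by blast
  obtain b where b: "y = (\<Sum>j<N. b j * B ^ j)" "\<forall>j. \<bar>b j\<bar> \<le> B - 1 \<and> sgn y * b j \<ge> 0"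
    using digits_exist[OF B lt(2)] by blast
  define J where "J = {j. j < N \<and> (a j \<noteq> 0 \<or> b j \<noteq> 0)}"
  have J_in: "j \<in> J \<longleftrightarrow> j < N \<and> (a j \<noteq> 0 \<or> b j \<noteq> 0)" for j
    by (simp add: J_def)
  have fin: "finite J" by (simp add: J_def)
  have "J \<noteq> {}"
  proof
    assume "J = {}"
    then have "x = 0" "y = 0" using a(1) b(1) by (auto simp: J_def)
    then show False using xy z(2) by (simp add: complex_eq_iff)
  qed
  then have mem: "Max J \<in> J" and ub: "\<And>j. j \<in> J \<Longrightarrow> j \<le> Max J"
    using fin by auto
  have zero: "a j = 0" "b j = 0" if "j < N" "\<not> j \<le> Max J" for j
    using ub[of j] that J_in[of j] by blast+
  have "(\<Sum>j<N. a j * B ^ j) = (\<Sum>j\<le>Max J. a j * B ^ j)"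
    using mem zero by (intro sum.mono_neutral_right) (auto simp: J_in)
  moreover have "(\<Sum>j<N. b j * B ^ j) = (\<Sum>j\<le>Max J. b j * B ^ j)"
    using mem zero by (intro sum.mono_neutral_right) (auto simp: J_in)
  ultimately have "gaussian_expansion B z (Max J) a b"
    unfolding xy gaussian_expansion_iff using a b mem[unfolded J_in] by (intro conjI allI impI) presburger+
  then show ?thesis by blast
qed

end

theory Submission
  imports Defs
begin

text \<open>
  A nonzero Gaussian integer has absolute value at least \<open>1\<close>, with equality only for the four
  units, and \<open>0\<close> is not happy. Each unit is its own single digit, so it is mapped to its square:
  \<open>\<plusminus>\<i> \<mapsto> -1 \<mapsto> 1 \<mapsto> 1\<close>. So all units are happy, of heights \<open>2, 1, 0\<close>, and in each of these
  heights the happy numbers of minimal absolute value are exactly the units.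
\<close>

text \<open>Some coordinate is a nonzero integer, and its absolute value bounds the modulus from
  below.\<close>

lemma gaussian_int_norm_ge_1:
  assumes "z \<in> gaussian_ints" "z \<noteq> 0"
  shows "1 \<le> cmod z"
proof -
  have "1 \<le> \<bar>Re z\<bar> \<or> 1 \<le> \<bar>Im z\<bar>"
    using assms by (auto simp: gaussian_ints_def complex_eq_iff intro: Ints_nonzero_abs_ge1)
  then show ?thesis
    using abs_Re_le_cmod[of z] abs_Im_le_cmod[of z] by linarith
qed

lemma gaussian_int_norm_eq_1_iff:
  assumes "z \<in> gaussian_ints"
  shows "cmod z = 1 \<longleftrightarrow> z \<in> {1, -1, \<i>, -\<i>}"
proof
  assume norm: "cmod z = 1"
  obtain x y where z: "z = Complex (of_int x) (of_int y)"
    using assms by (rule gaussian_intsE)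
  have "of_int (x\<^sup>2 + y\<^sup>2) = (1 :: real)"
    using norm by (simp add: z cmod_def)
  then have sq: "x\<^sup>2 + y\<^sup>2 = 1"
    by linarith
  then have "x\<^sup>2 \<le> 1\<^sup>2" "y\<^sup>2 \<le> 1\<^sup>2"
    using zero_le_power2[of x] zero_le_power2[of y] unfolding one_power2 by linarith+
  then have "\<bar>x\<bar> \<le> 1" "\<bar>y\<bar> \<le> 1"
    by (simp_all add: abs_square_le_1)
  \<comment> \<open>Of these nine pairs, \<open>sq\<close> keeps only the four units.\<close>
  then have "x \<in> {-1, 0, 1}" "y \<in> {-1, 0, 1}"
    by auto
  then show "z \<in> {1, -1, \<i>, -\<i>}"
    using sq by (auto simp: z complex_eq_iff)
qed auto

lemma gaussian_happy_fun_unit: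
  assumes "B \<ge> 2" "u \<in> {1, -1, \<i>, -\<i>}"
  shows "gaussian_happy_fun B u = u\<^sup>2"
proof -
  have u: "u \<in> gaussian_ints" "u \<noteq> 0"
    using assms(2) by (auto simp: gaussian_ints_def)
  obtain x y where xy: "u = Complex (of_int x) (of_int y)"
    using u(1) by (rule gaussian_intsE)
  \<comment> \<open>The digit bound holds since the coordinates of a unit are at most
    \<open>1 \<le> B - 1\<close> in absolute value. With top index \<open>0\<close>, only the digit
    at \<open>0\<close> matters, so constant sequences do.\<close>
  have "gaussian_expansion B u 0 (\<lambda>_. x) (\<lambda>_. y)"
    unfolding xy gaussian_expansion_iff using assms by (auto simp: xy complex_eq_iff)
  from gaussian_happy_fun_eq[OF assms(1) u this] show ?thesis
    by (simp add: xy Complex_eq mult.commute)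
qed

text \<open>The orbit of \<open>0\<close> stays at \<open>0\<close> and never reaches
  \<open>1\<close>.\<close>

lemma gaussian_happy_nonzero:
  assumes "gaussian_happy B z"
  shows "z \<noteq> 0"
proof
  assume "z = 0"
  moreover have "(gaussian_happy_fun B ^^ k) 0 = 0" for k
    by (induction k) (simp_all add: gaussian_happy_fun_def)
  ultimately show False
    using assms by (simp add: gaussian_happy_def)
qed

lemma gaussian_happy_unit:
  assumes "B \<ge> 2" "u \<in> {1, -1, \<i>, -\<i>}"
  shows "gaussian_happy B u"
proof -
  \<comment> \<open>Two squarings give \<open>u ^ 4 = 1\<close>, so the exponent \<open>2\<close>
    serves all four units.\<close>
  have "(gaussian_happy_fun B ^^ 2) u = 1"
    using assms by (auto simp: numeral_2_eq_2 gaussian_happy_fun_unit)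
  then show ?thesis
    using assms(2) unfolding gaussian_happy_def
    by (intro conjI exI[of _ 2]) (auto simp: gaussian_ints_def)
qed

lemma happy_height_unit:
  assumes "B \<ge> 2"
  shows "happy_height B 1 = 0" "happy_height B (-1) = 1"
    "happy_height B \<i> = 2" "happy_height B (-\<i>) = 2"
proof -
  note S = gaussian_happy_fun_unit[OF assms]
  show "happy_height B 1 = 0"
    unfolding happy_height_def by (rule Least_equality) auto
  have neq: "\<i> \<noteq> 1" "-\<i> \<noteq> 1" "(-1 :: complex) \<noteq> 1"
    by (auto simp: complex_eq_iff)
  show "happy_height B (-1) = 1"
    unfolding happy_height_def
  proof (rule Least_equality)
    fix k assume "(gaussian_happy_fun B ^^ k) (-1) = 1"
    then show "1 \<le> k" using neq by (cases k) auto
  qed (simp add: S)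
  have two: "2 \<le> k" if "(gaussian_happy_fun B ^^ k) u = 1" "u \<in> {\<i>, -\<i>}" for k u
  proof -
    \<comment> \<open>The iterates \<open>0\<close> and \<open>1\<close> of \<open>u\<close> are
      \<open>u\<close> itself and \<open>-1\<close>, both different from \<open>1\<close>.\<close>
    have "k \<noteq> 0"
      using that neq by (cases k) auto
    moreover have "k \<noteq> 1"
      using that by (auto simp: S)
    ultimately show ?thesis by simp
  qed
  show "happy_height B \<i> = 2"
    unfolding happy_height_def
    by (rule Least_equality) (use two in \<open>auto simp: numeral_2_eq_2 S\<close>)
  show "happy_height B (-\<i>) = 2"
    unfolding happy_height_def
    by (rule Least_equality) (use two in \<open>auto simp: numeral_2_eq_2 S\<close>)
qed

text \<open>The unit \<open>u\<close> shows that the lower bound \<open>1\<close> on the modulus is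
  attained at height \<open>k\<close>, so the minimizers are exactly the happy numbers of modulus
  \<open>1\<close> there.\<close>

lemma smallest_happy_of_height_eq_units:
  assumes B: "B \<ge> 2" and u: "u \<in> {1, -1, \<i>, -\<i>}" "happy_height B u = k"
  shows "smallest_happy_of_height B k = {v \<in> {1, -1, \<i>, -\<i>}. happy_height B v = k}"
proof -
  have ge: "1 \<le> cmod w" if "gaussian_happy B w" for w
    using gaussian_int_norm_ge_1 gaussian_happy_nonzero that by (auto simp: gaussian_happy_def)
  have norm: "cmod w = 1 \<longleftrightarrow> w \<in> {1, -1, \<i>, -\<i>}" if "gaussian_happy B w" for w
    using gaussian_int_norm_eq_1_iff that by (auto simp: gaussian_happy_def)
  have happy: "gaussian_happy B v" if "v \<in> {1, -1, \<i>, -\<i>}" for v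
    using gaussian_happy_unit[OF B that] .
  have "is_arg_min cmod (\<lambda>w. gaussian_happy B w \<and> happy_height B w = k) z \<longleftrightarrow>
      z \<in> {1, -1, \<i>, -\<i>} \<and> happy_height B z = k" for z
    unfolding is_arg_min_linorder using ge norm happy u by (metis order_antisym)
  then show ?thesis
    unfolding smallest_happy_of_height_def by blast
qed

theorem theorem8:
  fixes B :: int
  assumes "B \<ge> 2"
  shows "smallest_happy_of_height B 0 = {1} \<and>
         smallest_happy_of_height B 1 = {-1} \<and>
         smallest_happy_of_height B 2 = {\<i>, -\<i>}"
proof -
  note height = happy_height_unit[OF assms]
  note smallest = smallest_happy_of_height_eq_units[OF assms]
  show ?thesis
    using smallest[of 1 0] smallest[of "-1" 1] smallest[of \<i> 2] by (auto simp: height)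
qed

end
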